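(* In the staking pool formation game with $H,M,R,F$ fixed, for each $\lambda\in\left(\frac{M}{H+M},1\right]$ let $c^*(\lambda)$ be the threshold equilibrium. Then the fraction $F(c^*(\lambda))$ of honest agents running a pool in equilibrium is maximized for $\lambda=1$, i.e. $F(c^*(\lambda))\le F(c^*(1))$ for all $\lambda\in\left(\frac{M}{H+M},1\right]$.
   Context: Setting. There is a continuum of honest agents of measure $H$ and a continuum of malicious agents of measure $M$, with $H>M>0$. Every agent has one unit of stake. Honest agents' costs $c\ge 0$ of running a staking pool are distributed according to an atomless density with support interval $[0,T)$, $0<T\le\infty$, and cumulative distribution function $F$. There is a block reward $R>0$ and a sharing parameter $0<\lambda\le 1$. Malicious agents always run pools; honest agents run a pool or delegate. If $P$ and $D=H-P$ are the measures of honest pool owners and delegators, each pool has expected reward $\frac{R}{P+M}$, an honest pool owner with cost $c$ gets $\frac{\lambda R}{P+M}-c$, and a delegator gets $\frac{(1-\lambda)R}{D}$ (read as $0$ if $\lambda=1$, and as $+\infty$ if $\lambda<1$ and $D=0$). A threshold equilibrium is a cost level $c^*>0$ such that, with $P=F(c^* )H$ and $D=(1-F(c^* ))H$ (agents with cost below $c^*$ run pools, those with cost above $c^*$ delegate), an agent with cost $c^*$ is indifferent: $$c^*=\frac{\lambda R}{F(c^* )H+M}-\frac{(1-\lambda)R}{(1-F(c^* ))H}.$$ A unique threshold equilibrium $c^*(\lambda)$ exists exactly when $\lambda>\frac{M}{H+M}$; for smaller $\lambda$ there is no equilibrium in which a positive measure of honest agents runs pools. *)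

theory Defs
  imports "HOL-Probability.Probability"
begin

definition measure_support :: "'a::metric_space measure \<Rightarrow> 'a set" where
  "measure_support \<mu> = {x. \<forall>e>0. emeasure \<mu> (ball x e) > 0}"

text \<open>
  Costs have density \<open>f\<close> with respect to Lebesgue measure and support interval from 0 to
  \<open>T\<close>, where \<open>T = \<infinity>\<close> is allowed. The support of a measure is always closed, so it is compared
  with the closure of the half-open interval; as the distribution is atomless, the endpoint
  \<open>T\<close> carries no mass. Pointwise positivity of \<open>f\<close> is not required.
\<close>

definition cost_density :: "ereal \<Rightarrow> (real \<Rightarrow> real) \<Rightarrow> bool" where
  "cost_density T f \<longleftrightarrow>
     f \<in> borel_measurable borel \<and> (\<forall>x. 0 \<le> f x) \<and>
     prob_space (density lborel f) \<and>
     measure_support (density lborel f) = closure {c. 0 \<le> c \<and> ereal c < T}"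

definition pool_reward :: "real \<Rightarrow> real \<Rightarrow> real \<Rightarrow> real" where
  "pool_reward M R P = R / (P + M)"

definition delegator_payoff :: "real \<Rightarrow> real \<Rightarrow> real \<Rightarrow> ereal" where
  "delegator_payoff R lam D =
     (if lam = 1 then 0 else if D = 0 then \<infinity> else ereal ((1 - lam) * R / D))"

definition threshold_equilibrium ::
  "real \<Rightarrow> real \<Rightarrow> real \<Rightarrow> (real \<Rightarrow> real) \<Rightarrow> real \<Rightarrow> real \<Rightarrow> bool" where
  "threshold_equilibrium H M R F lam c \<longleftrightarrow>
     0 < c \<and>
     ereal c = ereal (lam * pool_reward M R (F c * H)) - delegator_payoff R lam ((1 - F c) * H)"

definition eq_threshold :: "real \<Rightarrow> real \<Rightarrow> real \<Rightarrow> (real \<Rightarrow> real) \<Rightarrow> real \<Rightarrow> real" where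
  "eq_threshold H M R F lam = (THE c. threshold_equilibrium H M R F lam c)"

lemma cost_cdf_properties:
  assumes f: "cost_density T f" and T: "0 < T"
  shows "continuous_on UNIV (cdf (density lborel f))" "mono (cdf (density lborel f))"
    "cdf (density lborel f) 0 = 0" "cdf (density lborel f) \<longlonglongrightarrow> 1"
    "\<And>c. 0 \<le> cdf (density lborel f) c" "\<And>c. cdf (density lborel f) c \<le> 1"
proof -
  let ?m = "density lborel f"
  have meas: "f \<in> borel_measurable borel"
    and sup: "measure_support ?m = closure {c. 0 \<le> c \<and> ereal c < T}"
    using f by (auto simp: cost_density_def)
  interpret prob_space ?m using f by (simp add: cost_density_def)
  interpret real_distribution ?m by unfold_locales auto
  have at0: "measure ?m {x} = 0" for x
  proof -
    have "emeasure ?m {x} = (\<integral>\<^sup>+y. ennreal (f y) * indicator {x} y \<partial>lborel)"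
      using meas by (subst emeasure_density) auto
    also have "\<dots> = 0"
      by (subst nn_integral_0_iff_AE) (use meas AE_lborel_singleton[of x] in auto)
    finally show ?thesis by (simp add: measure_def)
  qed
  show "continuous_on UNIV (cdf ?m)"
    by (simp add: continuous_on_eq_continuous_at isCont_cdf at0)
  show "mono (cdf ?m)" by (auto simp: mono_def cdf_nondecreasing)
  show "cdf ?m \<longlonglongrightarrow> 1"
    using cdf_lim_at_top_prob by (rule filterlim_compose) (rule filterlim_real_sequentially)
  show "0 \<le> cdf ?m c" "cdf ?m c \<le> 1" for c by (auto simp: cdf_nonneg cdf_bounded_prob)
  have "\<exists>e>0. ball x e \<in> null_sets ?m" if "x < 0" for x
  proof -
    have "closure {c. 0 \<le> c \<and> ereal c < T} \<subseteq> {0..}"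
      by (rule closure_minimal) auto
    with that sup have "x \<notin> measure_support ?m" by auto
    then show ?thesis by (auto simp: measure_support_def null_sets_def)
  qed
  then obtain e where e: "\<And>x. x < 0 \<Longrightarrow> e x > 0 \<and> ball x (e x) \<in> null_sets ?m" by metis
  obtain \<F> where \<F>: "\<F> \<subseteq> (\<lambda>x. ball x (e x)) ` {..<0}" "countable \<F>"
      "\<Union>\<F> = \<Union>((\<lambda>x. ball x (e x)) ` {..<0})"
    using Lindelof[of "(\<lambda>x. ball x (e x)) ` {..<0}"] by (metis (no_types, lifting) imageE open_ball)
  have "\<Union>\<F> \<in> null_sets ?m"
    using \<F>(1) e by (intro null_sets_UN'[OF \<F>(2), of "\<lambda>x. x", simplified]) auto
  moreover have "{..<0} \<subseteq> \<Union>\<F>" unfolding \<F>(3) using e by force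
  ultimately have "{..<0::real} \<in> null_sets ?m"
    using null_sets_subset[of "\<Union>\<F>" ?m "{..<0}"] by simp
  moreover have "{0::real} \<in> null_sets ?m"
    using at0[of 0] by (simp add: null_sets_def emeasure_eq_measure)
  ultimately have "{..<0} \<union> {0::real} \<in> null_sets ?m" by (rule null_sets.Un)
  moreover have "{..<0} \<union> {0::real} = {..0}" by auto
  ultimately show "cdf ?m 0 = 0" by (simp add: cdf_def null_sets_def measure_def)
qed

text \<open>The threshold equilibrium exists and is unique exactly for \<open>lam > M / (H + M)\<close>, so
  the description in \<open>eq_threshold\<close> is proper on that range.\<close>

lemma threshold_equilibrium_ex1_iff:
  assumes HM: "0 < M" "M < H" and R: "0 < R" and f: "cost_density T f" and T: "0 < T"
    and lam: "0 < lam" "lam \<le> 1"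
  shows "(\<exists>!c. threshold_equilibrium H M R (cdf (density lborel f)) lam c) \<longleftrightarrow> M / (H + M) < lam"
    and "lam \<le> M / (H + M) \<Longrightarrow> \<not> threshold_equilibrium H M R (cdf (density lborel f)) lam c"
proof -
  define F where "F = cdf (density lborel f)"
  note F = cost_cdf_properties[OF f T, folded F_def]
  have H: "0 < H" using HM by simp
  define A where "A p = lam * R / (p * H + M)" for p
  define B where "B p = (1 - lam) * R / ((1 - p) * H)" for p
  have eq: "threshold_equilibrium H M R F lam c \<longleftrightarrow>
      0 < c \<and> (lam = 1 \<or> F c < 1) \<and> c = A (F c) - B (F c)" for c
    using F(6)[of c] H
    by (auto simp: threshold_equilibrium_def delegator_payoff_def pool_reward_def A_def B_def)
  have Apos: "0 < p * H + M" if "0 \<le> p" for p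
    using that HM H by (simp add: add_nonneg_pos)
  have Amono: "A q \<le> A p" if "0 \<le> p" "p \<le> q" for p q
    unfolding A_def using that lam R H Apos[of p] Apos[of q]
    by (intro divide_left_mono mult_pos_pos) auto
  have Bmono: "B p \<le> B q" if "0 \<le> p" "p \<le> q" "lam = 1 \<or> q < 1" for p q
  proof (cases "lam = 1")
    case False
    then show ?thesis unfolding B_def using that lam R H
      by (intro divide_left_mono mult_pos_pos mult_right_mono) auto
  qed (simp add: B_def)
  have AB0: "A 0 - B 0 \<le> 0 \<longleftrightarrow> lam \<le> M / (H + M)"
  proof -
    have "A 0 - B 0 = R * (lam * (H + M) - M) / (M * H)"
      using HM H by (simp add: A_def B_def field_simps)
    also have "\<dots> \<le> 0 \<longleftrightarrow> lam * (H + M) \<le> M"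
      using HM H R by (simp add: divide_le_0_iff mult_le_0_iff)
    also have "\<dots> \<longleftrightarrow> lam \<le> M / (H + M)"
      using HM H by (simp add: pos_le_divide_eq)
    finally show ?thesis .
  qed
  show none: "\<not> threshold_equilibrium H M R (cdf (density lborel f)) lam c"
    if "lam \<le> M / (H + M)" for c
    using that AB0 Amono[of 0 "F c"] Bmono[of 0 "F c"] F(5)[of c] unfolding F_def[symmetric] eq
    by fastforce
  have le: "c' \<le> c" if "threshold_equilibrium H M R F lam c" "threshold_equilibrium H M R F lam c'"
    for c c'
  proof (rule ccontr)
    assume "\<not> c' \<le> c"
    then have "F c \<le> F c'" using F(2) by (simp add: mono_def)
    then have "A (F c') - B (F c') \<le> A (F c) - B (F c)"
      using Amono[of "F c" "F c'"] Bmono[of "F c" "F c'"] F(5)[of c] that by (auto simp: eq)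
    with that \<open>\<not> c' \<le> c\<close> show False by (auto simp: eq)
  qed
  have ex: "\<exists>c. threshold_equilibrium H M R F lam c" if l: "M / (H + M) < lam"
  proof -
    obtain b where b: "0 \<le> b" "lam = 1 \<or> F b < 1" "A (F b) - B (F b) \<le> b"
    proof (cases "lam = 1")
      case True
      then show ?thesis using that[of "A 0"] Amono[of 0 "F (A 0)"] F(5) R HM
        by (auto simp: B_def A_def)
    next
      case False
      then have "lam < 1" using lam by simp
      with F(4) have "\<forall>\<^sub>F n in sequentially. lam < F (real n)" by (rule order_tendstoD)
      then obtain n where n: "lam < F (real n)" by (auto simp: eventually_sequentially)
      obtain b where b: "0 \<le> b" "F b = lam"
        using IVT'[of F 0 lam "real n"] n lam F(3) continuous_on_subset[OF F(1)] by auto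
      have "A lam \<le> R / H"
      proof -
        have "A lam \<le> lam * R / (lam * H)"
          unfolding A_def using lam R H HM Apos[of lam] by (intro divide_left_mono mult_pos_pos) auto
        then show ?thesis using lam by simp
      qed
      moreover have "B lam = R / H" using \<open>lam < 1\<close> by (simp add: B_def)
      ultimately show ?thesis using that[of b] b \<open>lam < 1\<close> by simp
    qed
    define g where "g c = c - (A (F c) - B (F c))" for c
    have Fb: "lam = 1 \<or> F c < 1" if "c \<le> b" for c
      using b(2) F(2) that by (meson le_less_trans monoD)
    have contF: "continuous_on {0..b} F" using continuous_on_subset[OF F(1)] by auto
    have "continuous_on {0..b} (\<lambda>c. A (F c))"
      unfolding A_def using Apos F(5) by (intro continuous_intros contF) (metis less_irrefl)
    moreover have "continuous_on {0..b} (\<lambda>c. B (F c))"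
    proof (cases "lam = 1")
      case False
      then show ?thesis unfolding B_def using Fb H by (intro continuous_intros contF) force
    qed (simp add: B_def)
    ultimately have "continuous_on {0..b} g" unfolding g_def by (intro continuous_intros)
    moreover have g0: "g 0 < 0" using AB0 l F(3) by (simp add: g_def)
    moreover have "0 \<le> g b" using b by (simp add: g_def)
    ultimately obtain c where c: "0 \<le> c" "c \<le> b" "g c = 0"
      using IVT'[of g 0 0 b] b by auto
    with g0 have "c \<noteq> 0" by auto
    with c Fb[of c] show ?thesis by (auto simp: eq g_def intro!: exI[of _ c])
  qed
  show "(\<exists>!c. threshold_equilibrium H M R (cdf (density lborel f)) lam c) \<longleftrightarrow> M / (H + M) < lam"
    using none ex le unfolding F_def[symmetric] by (metis antisym not_le)
qed

end

theory Submission
  imports Defs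
begin

text \<open>For \<lambda> = 1 delegators get nothing, and the threshold d solves d = R / (F(d) H +
  M), whose right side is non-increasing in d. For any other \<lambda>, the factor \<lambda> \<le> 1
  and the subtracted non-negative delegator payoff only lower that right side, so a threshold c
  satisfies c \<le> R / (F(c) H + M). If c > d, this bound would be at most R / (F(d) H + M) = d, a
  contradiction. Hence c \<le> d, and monotonicity of F carries this over to the fractions of pool
  owners. Existence and uniqueness of the thresholds come from
  \<open>threshold_equilibrium_ex1_iff\<close>.\<close>

lemma threshold_equilibrium_le_full_sharing:
  assumes "0 < M" "0 < H" "0 < R" "lam \<le> 1"
    and F: "mono F" "\<And>x. 0 \<le> F x" "\<And>x. F x \<le> 1"
    and c: "threshold_equilibrium H M R F lam c"
    and d: "threshold_equilibrium H M R F 1 d"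
  shows "c \<le> d"
proof (rule ccontr)
  assume "\<not> c \<le> d"
  then have Fle: "F d \<le> F c" using F(1) by (simp add: mono_def)
  have pos: "0 < F x * H + M" for x
    using F(2)[of x] assms(1,2) by (simp add: add_nonneg_pos)
  \<comment> \<open>The payoff may be \<infinity> (when \<open>F c = 1\<close> and
    \<open>lam < 1\<close>), so it is dropped in \<open>ereal\<close> before passing to real
    inequalities.\<close>
  have "0 \<le> delegator_payoff R lam ((1 - F c) * H)"
    using F(3)[of c] assms(2-4) by (simp add: delegator_payoff_def)
  then have "ereal c \<le> ereal (lam * pool_reward M R (F c * H))"
    using c ereal_diff_le_self unfolding threshold_equilibrium_def by metis
  then have "c \<le> lam * (R / (F c * H + M))" by (simp add: pool_reward_def)
  also have "\<dots> \<le> R / (F c * H + M)"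
    using mult_right_mono[of lam 1 "R / (F c * H + M)"] assms(3,4) pos[of c] by simp
  also have "\<dots> \<le> R / (F d * H + M)"
    using Fle assms(2,3) pos by (intro divide_left_mono mult_pos_pos) auto
  \<comment> \<open>At full sharing the indifference condition has no delegator term, so it is
    exactly this equality.\<close>
  also have "\<dots> = d"
    using d by (simp add: threshold_equilibrium_def delegator_payoff_def pool_reward_def)
  finally show False using \<open>\<not> c \<le> d\<close> by simp
qed

theorem proposition1:
  fixes H M R :: real and T :: ereal and f F :: "real \<Rightarrow> real"
  assumes "0 < M" and "M < H" and "0 < R" and "0 < T"
    and "cost_density T f"
    and "F = cdf (density lborel f)"
  shows "\<forall>lam\<in>{M / (H + M)<..1}. F (eq_threshold H M R F lam) \<le> F (eq_threshold H M R F 1)"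
proof
  fix lam assume lam: "lam \<in> {M / (H + M)<..1}"
  note F = cost_cdf_properties[OF assms(5,4), folded assms(6)]
  have eq: "threshold_equilibrium H M R F l (eq_threshold H M R F l)"
    if "M / (H + M) < l" "l \<le> 1" for l
  proof -
    have "0 \<le> M / (H + M)" using assms(1,2) by simp
    with that have "0 < l" by linarith
    then have "\<exists>!c. threshold_equilibrium H M R F l c"
      using threshold_equilibrium_ex1_iff(1)[OF assms(1,2,3,5,4)] that by (simp add: assms(6))
    then show ?thesis unfolding eq_threshold_def by (rule theI')
  qed
  \<comment> \<open>The bound \<open>M / (H + M) < 1\<close> makes full sharing itself admissible,
    so \<open>eq\<close> applies to both \<open>lam\<close> and 1.\<close>
  have "0 < H" "M / (H + M) < 1" "M / (H + M) < lam" "lam \<le> 1"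
    using assms(1,2) lam by auto
  then have "eq_threshold H M R F lam \<le> eq_threshold H M R F 1"
    using threshold_equilibrium_le_full_sharing[OF assms(1) _ assms(3) _ F(2,5,6) eq eq] by blast
  with F(2) show "F (eq_threshold H M R F lam) \<le> F (eq_threshold H M R F 1)"
    by (rule monoD)
qed

end
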